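(* Let $(Z,d_Z)$ and $(W,d_W)$ be metric spaces, each with at least three points, and suppose that $f:(Z,d_Z)\to(W,d_W)$ is a $(\theta,\lambda)$-power quasi-symmetry with $\theta\ge 1$ and $\lambda\ge 1$. Then there is a $(\theta,k)$-rough quasi-isometry $\widehat f:(\mathrm{Con}_h(Z),\rho_{h,Z})\to(\mathrm{Con}_h(W),\rho_{h,W})$, where $k=k(\theta,\lambda)$ depends only on $\theta$ and $\lambda$. Furthermore, if $f$ is an $(\alpha,C)$-snowflake mapping with $\alpha>0$ and $C\ge 1$, then $\widehat f$ is an $(\alpha,k')$-rough similarity, where $k'=k'(\alpha,C)$ depends only on $\alpha$ and $C$.
   Context: Infinite hyperbolic cone: for a metric space $(Z,d_Z)$, $\mathrm{Con}_h(Z)=Z\times(0,\infty)$ with the metric $\rho_h=\rho_{h,Z}$ given by $\rho_h((x,s),(y,t))=2\log\left(\frac{d_Z(x,y)+\max\{s,t\}}{\sqrt{st}}\right)$. Power quasi-symmetry: a homeomorphism $f:(Z,d_Z)\to(W,d_W)$ is a $(\theta,\lambda)$-power quasi-symmetry ($\theta,\lambda\ge1$) if for all $x,y,z\in Z$ with $y\ne z$, $\frac{d_W(f(x),f(z))}{d_W(f(y),f(z))}\le\eta_{\theta,\lambda}\left(\frac{d_Z(x,z)}{d_Z(y,z)}\right)$, where $\eta_{\theta,\lambda}(0)=0$, $\eta_{\theta,\lambda}(t)=\lambda t^{1/\theta}$ for $0<t<1$ and $\eta_{\theta,\lambda}(t)=\lambda t^{\theta}$ for $t\ge1$. Snowflake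 mapping: a homeomorphism $f:(Z,d_Z)\to(W,d_W)$ is an $(\alpha,C)$-snowflake mapping if $C^{-1}d_Z(x,y)^\alpha\le d_W(f(x),f(y))\le C\,d_Z(x,y)^\alpha$ for all $x,y\in Z$. Let $g:(X,d_X)\to(Y,d_Y)$ be a map between metric spaces (not necessarily continuous) and $k\ge0$. The set $g(X)$ is $k$-cobounded in $Y$ if every point of $Y$ has distance at most $k$ from $g(X)$. For $\alpha\ge1$, $g$ is an $(\alpha,k)$-rough quasi-isometry if $g(X)$ is $k$-cobounded in $Y$ and $\alpha^{-1}d_X(x,z)-k\le d_Y(g(x),g(z))\le\alpha d_X(x,z)+k$ for all $x,z\in X$. For $\alpha>0$, $g$ is an $(\alpha,k)$-rough similarity if $g(X)$ is $k$-cobounded in $Y$ and $\alpha d_X(x,z)-k\le d_Y(g(x),g(z))\le\alpha d_X(x,z)+k$ for all $x,z\in X$.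
   Formalization: The same f̂ serves both claims only when 1/θ ≤ α ≤ θ; for other α a separate map is given, as no map can do both (identity of an equilateral 3-point space, θ=1, α=2). k and k' are uniform over all spaces carried by subsets of two arbitrary fixed sets. *)

theory Defs
  imports "HOL-Analysis.Analysis"
begin

text \<open>
  Metric spaces are values of the library type \<open>'a metric\<close> (a carrier \<open>mspace\<close> inside the type
  together with a metric \<open>mdist\<close>), so that a statement may quantify over all of them.
\<close>

text \<open>
  The library requires \<open>mdist\<close> to be symmetric and nonnegative off the carrier as well, whence the
  value 0 at nonpositive heights; it plays no role on the carrier (\<open>mdist_Con_h\<close> below).
\<close>

definition rho_h :: "'a metric \<Rightarrow> 'a \<times> real \<Rightarrow> 'a \<times> real \<Rightarrow> real" where
  "rho_h Z = (\<lambda>(x, s) (y, t).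
     if 0 < s \<and> 0 < t then 2 * ln ((mdist Z x y + max s t) / sqrt (s * t)) else 0)"

definition Con_h :: "'a metric \<Rightarrow> ('a \<times> real) metric" where
  "Con_h Z = metric (mspace Z \<times> {0<..}, rho_h Z)"

lemma max_le_add_max_div_sqrt:
  fixes d s t :: real
  assumes "0 \<le> d" "0 < s" "0 < t"
  shows "1 \<le> (d + max s t) / sqrt (s * t)"
    and "(d + max s t) / sqrt (s * t) = 1 \<longleftrightarrow> d = 0 \<and> s = t"
proof -
  define m where "m = max s t"
  have m: "0 < m" "s \<le> m" "t \<le> m" using assms by (auto simp: m_def)
  have st: "s * t \<le> m * m" using m assms by (intro mult_mono) auto
  have q: "0 < sqrt (s * t)" using assms by simp
  have le: "sqrt (s * t) \<le> m"
    using st m by (intro real_le_lsqrt) (auto simp: power2_eq_square)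
  show "1 \<le> (d + max s t) / sqrt (s * t)"
    using le q assms by (simp add: m_def[symmetric])
  show "(d + max s t) / sqrt (s * t) = 1 \<longleftrightarrow> d = 0 \<and> s = t"
  proof
    assume "(d + max s t) / sqrt (s * t) = 1"
    then have *: "d + m = sqrt (s * t)" using q by (simp add: m_def field_simps)
    then have d: "d = 0" and mq: "m = sqrt (s * t)" using le assms by linarith+
    have "m * m = s * t" using mq assms by (metis abs_of_pos mult_pos_pos real_sqrt_mult_self)
    moreover have "s * t = max s t * min s t" by (auto simp: max_def min_def)
    ultimately have "m = min s t" using m by (simp add: m_def)
    then show "d = 0 \<and> s = t" using d by (auto simp: m_def max_def min_def split: if_splits)
  next
    assume "d = 0 \<and> s = t"
    then show "(d + max s t) / sqrt (s * t) = 1" using assms by simp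
  qed
qed

lemma Metric_space_Con_h: "Metric_space (mspace Z \<times> {0<..}) (rho_h Z)"
proof
  fix p q :: "'a \<times> real"
  obtain x s y t where [simp]: "p = (x, s)" "q = (y, t)" by (cases p, cases q)
  show "0 \<le> rho_h Z p q"
    using max_le_add_max_div_sqrt(1)[of "mdist Z x y" s t] by (auto simp: rho_h_def)
  show "rho_h Z p q = rho_h Z q p"
    by (auto simp: rho_h_def mdist_commute max.commute mult.commute)
next
  fix p q :: "'a \<times> real"
  assume pq: "p \<in> mspace Z \<times> {0<..}" "q \<in> mspace Z \<times> {0<..}"
  obtain x s y t where [simp]: "p = (x, s)" "q = (y, t)" by (cases p, cases q)
  have st: "0 < s" "0 < t" using pq by auto
  define e where "e = (mdist Z x y + max s t) / sqrt (s * t)"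
  have "1 \<le> e" using st max_le_add_max_div_sqrt(1)[of "mdist Z x y" s t] by (simp add: e_def)
  then have "ln e = 0 \<longleftrightarrow> e = 1" by (intro ln_eq_zero_iff) simp
  then have "rho_h Z p q = 0 \<longleftrightarrow> e = 1" using st by (simp add: rho_h_def flip: e_def)
  also have "\<dots> \<longleftrightarrow> p = q"
    using max_le_add_max_div_sqrt(2)[of "mdist Z x y" s t] pq st by (simp add: e_def)
  finally show "rho_h Z p q = 0 \<longleftrightarrow> p = q" .
next
  fix p q r :: "'a \<times> real"
  assume pqr: "p \<in> mspace Z \<times> {0<..}" "q \<in> mspace Z \<times> {0<..}" "r \<in> mspace Z \<times> {0<..}"
  obtain x s y t z u where [simp]: "p = (x, s)" "q = (y, t)" "r = (z, u)"
    by (cases p, cases q, cases r)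
  have pos: "0 < s" "0 < t" "0 < u" using pqr by auto
  define a b c where "a = mdist Z x y" and "b = mdist Z y z" and "c = mdist Z x z"
  have abc: "0 \<le> a" "0 \<le> b" "0 \<le> c" "c \<le> a + b"
    using pqr by (auto simp: a_def b_def c_def intro: mdist_triangle)
  define A B C where "A = a + max s t" and "B = b + max t u" and "C = c + max s u"
  have ABC: "0 < A" "0 < B" "0 < C" using abc pos by (auto simp: A_def B_def C_def)
  have "C * t \<le> (a + b) * t + max s u * t"
    using abc pos mult_right_mono[of c "a + b" t] by (simp add: C_def algebra_simps)
  also have "\<dots> \<le> a * max t u + b * max s t + max s t * max t u"
  proof -
    have "a * t \<le> a * max t u" "b * t \<le> b * max s t" using abc by (auto intro: mult_left_mono)
    moreover have "max s u * t \<le> max s t * max t u"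
    proof (cases "s \<le> u")
      case True
      then have "max s u * t = t * u" by simp
      also have "\<dots> \<le> max s t * max t u" using pos by (intro mult_mono) auto
      finally show ?thesis .
    next
      case False
      then have "max s u * t = s * t" by simp
      also have "\<dots> \<le> max s t * max t u" using pos by (intro mult_mono) auto
      finally show ?thesis .
    qed
    ultimately show ?thesis by (simp add: algebra_simps)
  qed
  also have "\<dots> \<le> A * B" using abc by (simp add: A_def B_def algebra_simps)
  finally have main: "C * t \<le> A * B" .
  have lnq: "2 * ln (D / sqrt (v * w)) = 2 * ln D - ln v - ln w"
    if "0 < D" "0 < v" "0 < w" for D v w :: real
    using that by (simp add: ln_div ln_sqrt ln_mult add_divide_distrib)
  have "ln C + ln t \<le> ln A + ln B"
  proof -
    have "ln (C * t) \<le> ln (A * B)" using main ABC pos by (intro ln_mono) auto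
    then show ?thesis using ABC pos by (simp add: ln_mult)
  qed
  then show "rho_h Z p r \<le> rho_h Z p q + rho_h Z q r"
    using pos ABC by (simp add: rho_h_def lnq flip: a_def b_def c_def A_def B_def C_def)
qed

lemma mspace_Con_h [simp]: "mspace (Con_h Z) = mspace Z \<times> {0<..}"
  unfolding Con_h_def by (rule Metric_space.mspace_metric[OF Metric_space_Con_h])

lemma mdist_Con_h:
  assumes "0 < s" "0 < t"
  shows "mdist (Con_h Z) (x, s) (y, t) = 2 * ln ((mdist Z x y + max s t) / sqrt (s * t))"
proof -
  have "mdist (Con_h Z) = rho_h Z"
    unfolding Con_h_def by (rule Metric_space.mdist_metric[OF Metric_space_Con_h])
  then show ?thesis using assms by (simp add: rho_h_def)
qed

definition homeo :: "'a metric \<Rightarrow> 'b metric \<Rightarrow> ('a \<Rightarrow> 'b) \<Rightarrow> bool" where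
  "homeo Z W f \<longleftrightarrow> homeomorphic_map (mtopology_of Z) (mtopology_of W) f"

definition eta :: "real \<Rightarrow> real \<Rightarrow> real \<Rightarrow> real" where
  "eta \<theta> L t = (if t = 0 then 0 else if t < 1 then L * t powr (1 / \<theta>) else L * t powr \<theta>)"

definition power_quasi_symmetry ::
    "real \<Rightarrow> real \<Rightarrow> 'a metric \<Rightarrow> 'b metric \<Rightarrow> ('a \<Rightarrow> 'b) \<Rightarrow> bool" where
  "power_quasi_symmetry \<theta> L Z W f \<longleftrightarrow>
     1 \<le> \<theta> \<and> 1 \<le> L \<and> homeo Z W f \<and>
     (\<forall>x\<in>mspace Z. \<forall>y\<in>mspace Z. \<forall>z\<in>mspace Z. y \<noteq> z \<longrightarrow>
        mdist W (f x) (f z) / mdist W (f y) (f z) \<le> eta \<theta> L (mdist Z x z / mdist Z y z))"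

definition snowflake ::
    "real \<Rightarrow> real \<Rightarrow> 'a metric \<Rightarrow> 'b metric \<Rightarrow> ('a \<Rightarrow> 'b) \<Rightarrow> bool" where
  "snowflake \<alpha> C Z W f \<longleftrightarrow>
     homeo Z W f \<and>
     (\<forall>x\<in>mspace Z. \<forall>y\<in>mspace Z.
        inverse C * mdist Z x y powr \<alpha> \<le> mdist W (f x) (f y) \<and>
        mdist W (f x) (f y) \<le> C * mdist Z x y powr \<alpha>)"

text \<open>
  The distance from a point to a set is an infimum, which need not be attained; since the library
  leaves the infimum of the empty set of reals unspecified, that case is excluded by hand.
\<close>

definition cobounded_in :: "real \<Rightarrow> 'b metric \<Rightarrow> 'b set \<Rightarrow> bool" where
  "cobounded_in k Y S \<longleftrightarrow>
     (\<forall>y\<in>mspace Y. S \<noteq> {} \<and> (INF z\<in>S. mdist Y y z) \<le> k)"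

definition rough_quasi_isometry ::
    "real \<Rightarrow> real \<Rightarrow> 'a metric \<Rightarrow> 'b metric \<Rightarrow> ('a \<Rightarrow> 'b) \<Rightarrow> bool" where
  "rough_quasi_isometry \<alpha> k X Y g \<longleftrightarrow>
     1 \<le> \<alpha> \<and> 0 \<le> k \<and> g \<in> mspace X \<rightarrow> mspace Y \<and> cobounded_in k Y (g ` mspace X) \<and>
     (\<forall>x\<in>mspace X. \<forall>z\<in>mspace X.
        inverse \<alpha> * mdist X x z - k \<le> mdist Y (g x) (g z) \<and>
        mdist Y (g x) (g z) \<le> \<alpha> * mdist X x z + k)"

definition rough_similarity ::
    "real \<Rightarrow> real \<Rightarrow> 'a metric \<Rightarrow> 'b metric \<Rightarrow> ('a \<Rightarrow> 'b) \<Rightarrow> bool" where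
  "rough_similarity \<alpha> k X Y g \<longleftrightarrow>
     0 < \<alpha> \<and> 0 \<le> k \<and> g \<in> mspace X \<rightarrow> mspace Y \<and> cobounded_in k Y (g ` mspace X) \<and>
     (\<forall>x\<in>mspace X. \<forall>z\<in>mspace X.
        \<alpha> * mdist X x z - k \<le> mdist Y (g x) (g z) \<and>
        mdist Y (g x) (g z) \<le> \<alpha> * mdist X x z + k)"

text \<open>
  Hyperbolic cones are unbounded. Hence a map out of a cone that is both a \<open>\<theta>\<close>-rough quasi-isometry
  and an \<open>\<alpha>\<close>-rough similarity forces \<open>1 / \<theta> \<le> \<alpha> \<le> \<theta>\<close>, and it is an \<open>\<alpha>\<close>-rough similarity for at most
  one \<open>\<alpha>\<close>. On the other hand, a homeomorphism between finite spaces is a snowflake mapping for every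
  exponent, e.g. the identity of an equilateral three-point space of side length 1 is a
  \<open>(1, 1)\<close>-power quasi-symmetry and an \<open>(\<alpha>, 1)\<close>-snowflake mapping for every \<open>\<alpha> > 0\<close>. So the extension
  of a snowflake mapping has to be chosen after \<open>\<alpha>\<close>, and it can share the quasi-isometry bounds
  for \<open>\<theta>\<close> only in that range.
\<close>

lemma linear_bound_imp_le:
  fixes a b c :: real
  assumes "\<And>n::nat. a * real n \<le> b * real n + c"
  shows "a \<le> b"
proof (rule ccontr)
  assume "\<not> a \<le> b"
  then obtain n :: nat where "c < real n * (a - b)" using reals_Archimedean3[of "a - b"] by auto
  with assms[of n] show False by (simp add: algebra_simps)
qed

lemma Con_h_ray:
  assumes "z \<in> mspace Z"
  shows "(z, 1) \<in> mspace (Con_h Z)" "(z, exp (real n)) \<in> mspace (Con_h Z)"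
    and "mdist (Con_h Z) (z, 1) (z, exp (real n)) = real n"
proof -
  have "mdist Z z z = 0" using assms by simp
  then show "mdist (Con_h Z) (z, 1) (z, exp (real n)) = real n"
    by (simp add: mdist_Con_h ln_div ln_sqrt max_def)
qed (use assms in auto)

lemma rough_quasi_isometry_similarity_exponent:
  assumes "z \<in> mspace Z"
    and "rough_quasi_isometry \<theta> k (Con_h Z) Y g" "rough_similarity \<alpha> k' (Con_h Z) Y g"
  shows "1 / \<theta> \<le> \<alpha>" "\<alpha> \<le> \<theta>"
proof -
  note r = Con_h_ray[OF assms(1)]
  have q: "inverse \<theta> * real n - k \<le> mdist Y (g (z, 1)) (g (z, exp (real n)))"
          "mdist Y (g (z, 1)) (g (z, exp (real n))) \<le> \<theta> * real n + k" for n
    using assms(2) r(1) r(2,3)[of n] unfolding rough_quasi_isometry_def by metis+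
  have s: "\<alpha> * real n - k' \<le> mdist Y (g (z, 1)) (g (z, exp (real n)))"
          "mdist Y (g (z, 1)) (g (z, exp (real n))) \<le> \<alpha> * real n + k'" for n
    using assms(3) r(1) r(2,3)[of n] unfolding rough_similarity_def by metis+
  have "inverse \<theta> * real n \<le> \<alpha> * real n + (k + k')" "\<alpha> * real n \<le> \<theta> * real n + (k + k')" for n
    using q[of n] s[of n] by linarith+
  then have "inverse \<theta> \<le> \<alpha>" "\<alpha> \<le> \<theta>" by (blast intro: linear_bound_imp_le)+
  then show "1 / \<theta> \<le> \<alpha>" "\<alpha> \<le> \<theta>" by (simp_all add: inverse_eq_divide)
qed

lemma rough_similarity_exponent_unique:
  assumes "z \<in> mspace Z"
    and "rough_similarity \<alpha> k (Con_h Z) Y g" "rough_similarity \<beta> k' (Con_h Z) Y g"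
  shows "\<alpha> = \<beta>"
proof -
  note r = Con_h_ray[OF assms(1)]
  have q: "\<alpha> * real n - k \<le> mdist Y (g (z, 1)) (g (z, exp (real n)))"
          "mdist Y (g (z, 1)) (g (z, exp (real n))) \<le> \<alpha> * real n + k" for n
    using assms(2) r(1) r(2,3)[of n] unfolding rough_similarity_def by metis+
  have s: "\<beta> * real n - k' \<le> mdist Y (g (z, 1)) (g (z, exp (real n)))"
          "mdist Y (g (z, 1)) (g (z, exp (real n))) \<le> \<beta> * real n + k'" for n
    using assms(3) r(1) r(2,3)[of n] unfolding rough_similarity_def by metis+
  have "\<alpha> * real n \<le> \<beta> * real n + (k + k')" "\<beta> * real n \<le> \<alpha> * real n + (k + k')" for n
    using q[of n] s[of n] by linarith+
  then have "\<alpha> \<le> \<beta>" "\<beta> \<le> \<alpha>" by (blast intro: linear_bound_imp_le)+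
  then show ?thesis by simp
qed

end

theory Submission
  imports Defs
begin

text \<open>
  The extension is \<open>(x, s) \<mapsto> (f x, h x s)\<close>, which is rough as soon as \<open>h x\<close> grows between two
  powers, \<open>h x s\<close> and \<open>h y s\<close> are comparable for \<open>d(x, y) \<le> s\<close>, and \<open>h x s\<close> is comparable to
  \<open>d'(x, y) = d(f x, f y)\<close> for \<open>s = d(x, y) > 0\<close>. At scales \<open>s\<close> that are not distances from
  \<open>x\<close>, the height is obtained by a McShane extension on the logarithmic scale, as the supremum over
  \<open>z \<noteq> x\<close> of \<open>d'(x, z) m(s / d(x, z))\<close> with \<open>m(u) = min(u\<^sup>1\<^sup>/\<^sup>\<theta>, u\<^sup>\<theta>)\<close>. On long gaps
  without distances this supremum may drop below \<open>s\<^sup>\<alpha>\<close> by an unbounded factor; taking the maximum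
  with \<open>c s\<^sup>\<alpha>\<close>, where \<open>c d\<^sup>\<alpha> \<le> d'\<close>, gives a snowflake mapping the right height without affecting
  the bounds that depend on \<open>\<theta>\<close> and \<open>L\<close> only. If \<open>\<alpha>\<close> is not in \<open>[1/\<theta>, \<theta>]\<close>, then the height
  \<open>s\<^sup>\<alpha>\<close> is good enough.
\<close>

section \<open>Cone distances on the logarithmic scale, and elementary facts on
  homeomorphisms\<close>

lemma mdist_Con_h_ln:
  assumes "0 < s" "0 < t"
  shows "mdist (Con_h Z) (x, s) (y, t) = 2 * ln (mdist Z x y + max s t) - ln s - ln t"
proof -
  have "0 < mdist Z x y + max s t"
    using assms mdist_nonneg[of Z x y] by linarith
  then show ?thesis
    using assms by (simp add: mdist_Con_h ln_div ln_sqrt ln_mult field_simps del: add_divide_distrib)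
qed

lemma mdist_pos:
  assumes "x \<in> mspace Z" "y \<in> mspace Z" "x \<noteq> y"
  shows "0 < mdist Z x y"
  using assms mdist_nonneg[of Z x y] by (simp add: less_le)

lemma homeo_mspaceD:
  assumes "homeo Z W f"
  shows "inj_on f (mspace Z)" "f ` mspace Z = mspace W"
  using homeomorphic_imp_injective_map[of _ _ f] homeomorphic_imp_surjective_map[of _ _ f] assms
  unfolding homeo_def by fastforce+

section \<open>Extending a map to the cones by a height function\<close>

text \<open>All conditions are multiplicative with one constant \<open>B\<close>, so that they turn
  into additive errors under the logarithm. Separate exponents \<open>a\<close> and \<open>b\<close>
  let one argument serve rough quasi-isometries (\<open>a = 1 / b\<close>) and rough similarities
  (\<open>a = b\<close>). One inequality in \<open>change_point\<close> suffices, as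
  \<open>x\<close> and \<open>y\<close> may be exchanged.\<close>

locale cone_extension =
  fixes Z :: "'a metric" and W :: "'b metric" and f :: "'a \<Rightarrow> 'b"
    and h :: "'a \<Rightarrow> real \<Rightarrow> real" and a b B :: real
  assumes surj: "f ` mspace Z = mspace W"
    and exponents: "0 < a" "0 < b" and B: "1 \<le> B"
    and pos: "\<And>x s. x \<in> mspace Z \<Longrightarrow> 0 < s \<Longrightarrow> 0 < h x s"
    and growth_lower: "\<And>x s t. x \<in> mspace Z \<Longrightarrow> 0 < s \<Longrightarrow> s \<le> t \<Longrightarrow>
          h x s * (t / s) powr a \<le> B * h x t"
    and growth_upper: "\<And>x s t. x \<in> mspace Z \<Longrightarrow> 0 < s \<Longrightarrow> s \<le> t \<Longrightarrow>
          h x t \<le> B * h x s * (t / s) powr b"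
    and change_point: "\<And>x y s. x \<in> mspace Z \<Longrightarrow> y \<in> mspace Z \<Longrightarrow> 0 < s \<Longrightarrow> mdist Z x y \<le> s \<Longrightarrow>
          h x s \<le> B * h y s"
    and edge_lower: "\<And>x y. x \<in> mspace Z \<Longrightarrow> y \<in> mspace Z \<Longrightarrow> x \<noteq> y \<Longrightarrow>
          mdist W (f x) (f y) \<le> B * h x (mdist Z x y)"
    and edge_upper: "\<And>x y. x \<in> mspace Z \<Longrightarrow> y \<in> mspace Z \<Longrightarrow> x \<noteq> y \<Longrightarrow>
          h x (mdist Z x y) \<le> B * mdist W (f x) (f y)"
begin

definition lift :: "'a \<times> real \<Rightarrow> 'b \<times> real" where
  "lift = (\<lambda>(x, s). (f x, h x s))"

text \<open>A common bound for three losses: \<open>6 * ln B + 2 * ln 2\<close> in the upper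
  distance estimate, \<open>6 * ln B + 2 * a * ln 2\<close> in the lower one and
  \<open>ln B + b * ln 2\<close> for coboundedness.\<close>

definition error :: real where
  "error = 6 * ln B + (2 + 2 * a + b) * ln 2"

lemma error_nonneg: "0 \<le> error"
  using B exponents by (simp add: error_def)

lemma lift_maps: "lift \<in> mspace (Con_h Z) \<rightarrow> mspace (Con_h W)"
  using surj pos by (auto simp: lift_def)

lemma quasi_mono:
  assumes "x \<in> mspace Z" "0 < s" "s \<le> t"
  shows "h x s \<le> B * h x t"
proof -
  have "1 \<le> (t / s) powr a"
    using assms exponents by (intro ge_one_powr_ge_zero) auto
  then have "h x s \<le> h x s * (t / s) powr a"
    using pos[OF assms(1,2)] by simp
  with growth_lower[OF assms] show ?thesis by linarith
qed

lemma ln_growth: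
  assumes "x \<in> mspace Z" "0 < s" "s \<le> t"
  shows "a * (ln t - ln s) - ln B \<le> ln (h x t) - ln (h x s)"
    and "ln (h x t) - ln (h x s) \<le> b * (ln t - ln s) + ln B"
proof -
  have t: "0 < t" using assms by linarith
  note p = pos[OF assms(1,2)] pos[OF assms(1) t]
  have "ln (h x s * (t / s) powr a) \<le> ln (B * h x t)"
    using growth_lower[OF assms] p B t assms by (subst ln_le_cancel_iff) auto
  then show "a * (ln t - ln s) - ln B \<le> ln (h x t) - ln (h x s)"
    using p B t assms by (simp add: ln_mult ln_powr ln_div)
  have "ln (h x t) \<le> ln (B * h x s * (t / s) powr b)"
    using growth_upper[OF assms] p B t assms by (subst ln_le_cancel_iff) auto
  then show "ln (h x t) - ln (h x s) \<le> b * (ln t - ln s) + ln B"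
    using p B t assms by (simp add: ln_mult ln_powr ln_div)
qed

text \<open>
  With \<open>T\<close> the larger of \<open>d(x, y)\<close>, \<open>s\<close> and \<open>t\<close>, both numerators in the cone distances are
  determined by \<open>T\<close>: the one in \<open>Z\<close> is comparable to \<open>T\<close>, the one in \<open>W\<close> to \<open>h x T\<close>.
\<close>

lemma numerator_bounds:
  fixes s t :: real
  assumes "x \<in> mspace Z" "y \<in> mspace Z" "0 < s" "0 < t"
  defines "T \<equiv> max (mdist Z x y) (max s t)"
    and "N \<equiv> mdist W (f x) (f y) + max (h x s) (h y t)"
  shows "N \<le> 2 * B\<^sup>2 * h x T" "h x T \<le> B\<^sup>2 * N"
proof -
  note xy = assms(1,2)
  have T: "0 < T" "mdist Z x y \<le> T" "s \<le> T" "t \<le> T"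
    using assms by (auto simp: T_def)
  have hT: "0 < h x T" "0 < h y T" using pos xy T by auto
  have B2: "B * v \<le> B\<^sup>2 * v" if "0 \<le> v" for v
    using B that by (intro mult_right_mono) (auto simp: power2_eq_square)
  have sq: "B * (B * v) = B\<^sup>2 * v" for v by (simp add: power2_eq_square)
  have "h x s \<le> B * h x T" using quasi_mono[of x s T] xy T assms by simp
  also have "\<dots> \<le> B\<^sup>2 * h x T" using B2 hT by simp
  finally have 1: "h x s \<le> B\<^sup>2 * h x T" .
  have "h y t \<le> B * h y T" using quasi_mono[of y t T] xy T assms by simp
  also have "\<dots> \<le> B * (B * h x T)"
    using change_point[of y x T] xy T B by (intro mult_left_mono) (auto simp: mdist_commute)
  finally have 2: "h y t \<le> B\<^sup>2 * h x T" by (simp add: sq)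
  have 3: "mdist W (f x) (f y) \<le> B\<^sup>2 * h x T"
  proof (cases "x = y")
    case True
    moreover from this have "f y \<in> mspace W" using surj xy by auto
    then have "mdist W (f y) (f y) = 0" by simp
    ultimately show ?thesis using hT by simp
  next
    case False
    then have d: "0 < mdist Z x y"
      using xy by (simp add: mdist_pos)
    have "mdist W (f x) (f y) \<le> B * h x (mdist Z x y)" using edge_lower xy False by simp
    also have "\<dots> \<le> B * (B * h x T)"
      using quasi_mono[of x "mdist Z x y" T] xy d T B by (intro mult_left_mono) auto
    finally show ?thesis by (simp add: sq)
  qed
  show "N \<le> 2 * B\<^sup>2 * h x T" using 1 2 3 by (auto simp: N_def)
  have N: "mdist W (f x) (f y) \<le> N" "h x s \<le> N" "h y t \<le> N"
  proof -
    have "0 \<le> mdist W (f x) (f y)" "0 < h x s" using pos xy assms by auto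
    then show "mdist W (f x) (f y) \<le> N" "h x s \<le> N" "h y t \<le> N"
      unfolding N_def by linarith+
  qed
  have N0: "0 \<le> N" using N(1) by (rule order_trans[OF mdist_nonneg])
  \<comment> \<open>The maximum \<open>T\<close> is attained by one of three quantities, and each of
    them corresponds to one term of \<open>N\<close>. In the last case \<open>x = y\<close> would
    give \<open>T = 0\<close>.\<close>
  consider "T = s" | "T = t" | "T = mdist Z x y" "x \<noteq> y"
  proof -
    have "T \<noteq> 0" using T by simp
    then show thesis using that xy by (auto simp: T_def max_def split: if_splits)
  qed
  then have "h x T \<le> B * N"
  proof cases
    case 1
    have "N \<le> B * N" using B N0 mult_right_mono[of 1 B N] by simp
    with 1 N show ?thesis by simp
  next
    case 2
    have "h x T \<le> B * h y T" using change_point[of x y T] xy T by simp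
    also have "\<dots> \<le> B * N" using N 2 B by (intro mult_left_mono) auto
    finally show ?thesis .
  next
    case 3
    have "h x T \<le> B * mdist W (f x) (f y)" using edge_upper[of x y] 3 xy by simp
    also have "\<dots> \<le> B * N" using N B by (intro mult_left_mono) auto
    finally show ?thesis .
  qed
  also have "\<dots> \<le> B\<^sup>2 * N" using B2 N0 by simp
  finally show "h x T \<le> B\<^sup>2 * N" .
qed

text \<open>Of the two copies of \<open>ln N\<close> in the cone distance, one is compared with
  \<open>ln (h x T)\<close> and the other with \<open>ln (h y T)\<close>. What remains is the growth
  of \<open>h x\<close> from \<open>s\<close> to \<open>T\<close> and of \<open>h y\<close> from
  \<open>t\<close> to \<open>T\<close>.\<close>

lemma lift_bounds:
  assumes "p \<in> mspace (Con_h Z)" "q \<in> mspace (Con_h Z)"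
  shows "a * mdist (Con_h Z) p q - error \<le> mdist (Con_h W) (lift p) (lift q)"
    and "mdist (Con_h W) (lift p) (lift q) \<le> b * mdist (Con_h Z) p q + error"
proof -
  obtain x s y t where pq: "p = (x, s)" "q = (y, t)" by (cases p, cases q)
  have xy: "x \<in> mspace Z" "y \<in> mspace Z" and st: "0 < s" "0 < t" using assms pq by auto
  define d T N where "d = mdist Z x y" and "T = max d (max s t)"
    and "N = mdist W (f x) (f y) + max (h x s) (h y t)"
  have d: "0 \<le> d" by (simp add: d_def)
  have T: "0 < T" "s \<le> T" "t \<le> T" "d + max s t \<le> 2 * T" "T \<le> d + max s t"
    using st d by (auto simp: T_def)
  have hT: "0 < h x T" "0 < h y T" using pos xy T by auto
  have hs: "0 < h x s" "0 < h y t" using pos xy st by auto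
  have Nx: "N \<le> 2 * B\<^sup>2 * h x T" "h x T \<le> B\<^sup>2 * N"
    using numerator_bounds[OF xy st] by (auto simp: N_def T_def d_def)
  have Ny: "N \<le> 2 * B\<^sup>2 * h y T" "h y T \<le> B\<^sup>2 * N"
    using numerator_bounds[of y x t s] xy st
    by (auto simp: N_def T_def d_def mdist_commute max.commute)
  have "0 < N" using hs mdist_nonneg[of W "f x" "f y"] unfolding N_def by linarith
  have lnN: "ln N \<le> ln 2 + 2 * ln B + ln v" "ln v \<le> 2 * ln B + ln N"
    if "N \<le> 2 * B\<^sup>2 * v" "v \<le> B\<^sup>2 * N" "0 < v" for v
  proof -
    have "ln N \<le> ln (2 * B\<^sup>2 * v)"
      using that B \<open>0 < N\<close> by (subst ln_le_cancel_iff) auto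
    then show "ln N \<le> ln 2 + 2 * ln B + ln v"
      using B that by (simp add: ln_mult ln_realpow)
    have "ln v \<le> ln (B\<^sup>2 * N)" using that B \<open>0 < N\<close> by (subst ln_le_cancel_iff) auto
    then show "ln v \<le> 2 * ln B + ln N" using B \<open>0 < N\<close> by (simp add: ln_mult ln_realpow)
  qed
  note lx = lnN[OF Nx hT(1)] and ly = lnN[OF Ny hT(2)]
  note gx = ln_growth[OF xy(1) st(1) T(2)] and gy = ln_growth[OF xy(2) st(2) T(3)]
  define D where "D = ln (d + max s t)"
  have "D \<le> ln (2 * T)" "ln T \<le> D"
    unfolding D_def using T by (subst ln_le_cancel_iff; auto)+
  then have D: "D \<le> ln 2 + ln T" "ln T \<le> D" using T by (auto simp: ln_mult)
  have Zd: "mdist (Con_h Z) p q = 2 * D - ln s - ln t"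
    using st by (simp add: pq mdist_Con_h_ln D_def d_def)
  have Wd: "mdist (Con_h W) (lift p) (lift q) = 2 * ln N - ln (h x s) - ln (h y t)"
    using hs by (simp add: pq lift_def mdist_Con_h_ln N_def)
  have b0: "0 \<le> b * ln 2" and a0: "0 \<le> a * ln 2" and lB: "0 \<le> ln B"
    using exponents B by auto
  have l2: "0 \<le> ln (2::real)" by simp
  have bD: "b * (2 * ln T - ln s - ln t) \<le> b * (2 * D - ln s - ln t)"
    using D exponents by (intro mult_left_mono) auto
  show "mdist (Con_h W) (lift p) (lift q) \<le> b * mdist (Con_h Z) p q + error"
    using bD lx(1) ly(1) gx(2) gy(2) a0 b0 lB unfolding Zd Wd error_def
    by (simp add: algebra_simps)
  have aD: "a * (2 * D - ln s - ln t) \<le> a * (2 * (ln 2 + ln T) - ln s - ln t)"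
    using D exponents by (intro mult_left_mono) auto
  show "a * mdist (Con_h Z) p q - error \<le> mdist (Con_h W) (lift p) (lift q)"
    using aD lx(2) ly(2) gx(1) gy(1) a0 b0 lB l2 unfolding Zd Wd error_def
    by (simp only: algebra_simps)
qed

text \<open>Nothing makes \<open>h x\<close> continuous, so an intermediate value argument is
  replaced by a supremum. By \<open>growth_lower\<close>, the set \<open>S\<close> of scales with
  height at most \<open>u\<close> is nonempty and bounded. If \<open>s\<close> in \<open>S\<close>
  exceeds half its supremum, then \<open>2 * s\<close> is outside \<open>S\<close>, and
  \<open>growth_upper\<close> bounds the loss from doubling.\<close>

lemma height_coarsely_surj:
  assumes "x \<in> mspace Z" "0 < u"
  obtains s where "0 < s" "h x s \<le> u" "u \<le> B * 2 powr b * h x s"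
proof -
  note x = assms(1)
  have h1: "0 < h x 1" using pos x by simp
  define S where "S = {s. 0 < s \<and> h x s \<le> u}"
  \<comment> \<open>The second argument solves \<open>B * h x 1 * s powr a = u\<close>; the cap at 1
    allows \<open>growth_lower\<close> to be applied from \<open>s0\<close> to 1.\<close>
  define s0 where "s0 = min 1 ((u / (B * h x 1)) powr (1 / a))"
  have s0: "0 < s0" "s0 \<le> 1" using assms B h1 by (auto simp: s0_def)
  have "s0 powr a \<le> ((u / (B * h x 1)) powr (1 / a)) powr a"
    using exponents s0 by (intro powr_mono2) (auto simp: s0_def)
  also have "\<dots> = u / (B * h x 1)" using exponents assms B h1 by (simp add: powr_powr)
  finally have s0a: "s0 powr a \<le> u / (B * h x 1)" .
  have "h x s0 * (1 / s0) powr a \<le> B * h x 1" using growth_lower[OF x s0] .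
  then have "h x s0 \<le> B * h x 1 * s0 powr a"
    using s0 by (simp add: powr_divide field_simps)
  also have "\<dots> \<le> B * h x 1 * (u / (B * h x 1))"
    using s0a B h1 by (intro mult_left_mono) auto
  finally have "s0 \<in> S" using s0 B h1 by (simp add: S_def)
  have bdd: "s \<le> max 1 ((B * u / h x 1) powr (1 / a))" if "s \<in> S" for s
  proof (cases "s \<le> 1")
    case False
    then have "h x 1 * s powr a \<le> B * h x s" using growth_lower[OF x, of 1 s] by simp
    also have "\<dots> \<le> B * u" using that B by (auto simp: S_def)
    finally have "s powr a \<le> B * u / h x 1" using h1 by (simp add: field_simps)
    then have "(s powr a) powr (1 / a) \<le> (B * u / h x 1) powr (1 / a)"
      using exponents by (intro powr_mono2) auto
    then show ?thesis using exponents False by (simp add: powr_powr)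
  qed simp
  then have bddS: "bdd_above S" by (rule bdd_aboveI)
  have "s0 \<le> Sup S" using \<open>s0 \<in> S\<close> bddS by (rule cSup_upper)
  then have "Sup S / 2 < Sup S" using s0 by simp
  then obtain s where s: "s \<in> S" "Sup S / 2 < s"
    using less_cSup_iff[OF _ bddS] \<open>s0 \<in> S\<close> by blast
  then have "2 * s \<notin> S" using cSup_upper[OF _ bddS, of "2 * s"] by auto
  then have "u < h x (2 * s)" using s by (auto simp: S_def)
  also have "\<dots> \<le> B * h x s * (2 * s / s) powr b"
    using growth_upper[OF x, of s "2 * s"] s by (simp add: S_def)
  finally show thesis using that[of s] s by (simp add: S_def mult_ac)
qed

text \<open>Since \<open>f\<close> is onto, only the height has to be matched: a vertical move in
  the cone costs the logarithm of the ratio of the heights.\<close>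

lemma lift_cobounded: "cobounded_in error (Con_h W) (lift ` mspace (Con_h Z))"
  unfolding cobounded_in_def
proof (intro ballI conjI)
  fix q assume "q \<in> mspace (Con_h W)"
  then obtain x u where q: "q = (f x, u)" "x \<in> mspace Z" "0 < u"
    by (auto simp flip: surj)
  obtain s where s: "0 < s" "h x s \<le> u" "u \<le> B * 2 powr b * h x s"
    using height_coarsely_surj[OF q(2,3)] .
  have hs: "0 < h x s" using pos q s by simp
  have "f x \<in> mspace W" using surj q by blast
  then have fx: "mdist W (f x) (f x) = 0" by simp
  have p: "(x, s) \<in> mspace (Con_h Z)" using q s by simp
  then show "lift ` mspace (Con_h Z) \<noteq> {}" by blast
  have "ln u \<le> ln (B * 2 powr b * h x s)"
    using s q hs B by (subst ln_le_cancel_iff) auto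
  then have "ln u \<le> ln B + b * ln 2 + ln (h x s)"
    using hs B by (simp add: ln_mult ln_powr)
  moreover have "0 \<le> ln B" "0 \<le> a * ln 2" "0 \<le> ln (2::real)" using B exponents by auto
  moreover have "mdist (Con_h W) q (lift (x, s)) = ln u - ln (h x s)"
    using q s hs fx by (simp add: lift_def mdist_Con_h_ln max_def)
  ultimately have "mdist (Con_h W) q (lift (x, s)) \<le> error"
    by (simp only: error_def algebra_simps)
  moreover have "bdd_below (mdist (Con_h W) q ` (lift ` mspace (Con_h Z)))"
    by (rule bdd_belowI[of _ 0]) auto
  ultimately show "(INF z\<in>lift ` mspace (Con_h Z). mdist (Con_h W) q z) \<le> error"
    using p by (intro cINF_lower2[of _ _ "lift (x, s)"]) auto
qed

lemma lift_rough_quasi_isometry: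
  assumes "a = 1 / b" "1 \<le> b"
  shows "rough_quasi_isometry b error (Con_h Z) (Con_h W) lift"
  unfolding rough_quasi_isometry_def
  using assms error_nonneg lift_maps lift_cobounded lift_bounds by (simp add: inverse_eq_divide)

lemma lift_rough_similarity:
  assumes "a = b"
  shows "rough_similarity b error (Con_h Z) (Con_h W) lift"
  unfolding rough_similarity_def
  using assms exponents error_nonneg lift_maps lift_cobounded lift_bounds by simp

end

text \<open>Both the height and the distances in the image are comparable to the same power with
  constant \<open>C\<close>. Each condition passes through that power, which costs \<open>C\<close>
  twice.\<close>

lemma cone_extension_snowflake:
  fixes f :: "'a \<Rightarrow> 'b"
  assumes sf: "snowflake \<alpha> C Z W f" and \<alpha>: "0 < \<alpha>" and C: "1 \<le> C"
    and lower: "\<And>x s. x \<in> mspace Z \<Longrightarrow> 0 < s \<Longrightarrow> s powr \<alpha> \<le> C * h x s"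
    and upper: "\<And>x s. x \<in> mspace Z \<Longrightarrow> 0 < s \<Longrightarrow> h x s \<le> C * s powr \<alpha>"
  shows "cone_extension Z W f h \<alpha> \<alpha> (C\<^sup>2)"
proof
  show "f ` mspace Z = mspace W"
    using sf homeo_mspaceD(2) unfolding snowflake_def by blast
  show "0 < \<alpha>" by (rule \<alpha>)
  show "1 \<le> C\<^sup>2" using C by simp
  have sq: "C * (C * v) = C\<^sup>2 * v" for v by (simp add: power2_eq_square)
  have C_mono: "C * v \<le> C * w" if "v \<le> w" for v w
    using that C by (intro mult_left_mono) auto
  show "0 < h x s" if "x \<in> mspace Z" "0 < s" for x s
  proof -
    have "0 < C * h x s" using lower[OF that] powr_gt_zero[of s \<alpha>] that by linarith
    then show ?thesis using C by (simp add: zero_less_mult_iff)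
  qed
  have compare: "h x s \<le> C\<^sup>2 * h y s" if "x \<in> mspace Z" "y \<in> mspace Z" "0 < s" for x y s
  proof -
    have "h x s \<le> C * s powr \<alpha>" using upper that by simp
    also have "\<dots> \<le> C * (C * h y s)" using lower that by (intro C_mono) auto
    finally show ?thesis by (simp add: sq)
  qed
  then show "h x s \<le> C\<^sup>2 * h y s"
    if "x \<in> mspace Z" "y \<in> mspace Z" "0 < s" "mdist Z x y \<le> s" for x y s
    using that by simp
  fix x s t assume x: "x \<in> mspace Z" and st: "0 < (s::real)" "s \<le> t"
  then have t: "0 < t" by linarith
  have ratio: "s powr \<alpha> * (t / s) powr \<alpha> = t powr \<alpha>"
    using st t by (simp flip: powr_mult)
  have "h x s * (t / s) powr \<alpha> \<le> C * s powr \<alpha> * (t / s) powr \<alpha>"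
    using upper x st by (intro mult_right_mono) auto
  also have "\<dots> \<le> C * (C * h x t)"
    using lower[OF x t] ratio by (simp add: mult.assoc C_mono)
  finally show "h x s * (t / s) powr \<alpha> \<le> C\<^sup>2 * h x t" by (simp add: sq)
  have "h x t \<le> C * (s powr \<alpha> * (t / s) powr \<alpha>)"
    using upper[OF x t] by (simp add: ratio)
  also have "\<dots> \<le> C * (C * h x s * (t / s) powr \<alpha>)"
    using lower[OF x st(1)] by (intro C_mono mult_right_mono) auto
  finally show "h x t \<le> C\<^sup>2 * h x s * (t / s) powr \<alpha>" by (simp add: sq mult.assoc)
next
  fix x y assume xy: "x \<in> mspace Z" "y \<in> mspace Z" "x \<noteq> y"
  have sq: "C * (C * v) = C\<^sup>2 * v" for v by (simp add: power2_eq_square)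
  have d: "0 < mdist Z x y" using xy by (simp add: mdist_pos)
  have "mdist W (f x) (f y) \<le> C * mdist Z x y powr \<alpha>"
    using sf xy by (auto simp: snowflake_def)
  also have "\<dots> \<le> C * (C * h x (mdist Z x y))"
    using lower[OF xy(1) d] C by (intro mult_left_mono) auto
  finally show "mdist W (f x) (f y) \<le> C\<^sup>2 * h x (mdist Z x y)" by (simp add: sq)
  have "inverse C * mdist Z x y powr \<alpha> \<le> mdist W (f x) (f y)"
    using sf xy by (auto simp: snowflake_def)
  then have "mdist Z x y powr \<alpha> \<le> C * mdist W (f x) (f y)"
    using C by (simp add: field_simps)
  then have "C * mdist Z x y powr \<alpha> \<le> C * (C * mdist W (f x) (f y))"
    using C by (intro mult_left_mono) auto
  with upper[OF xy(1) d] show "h x (mdist Z x y) \<le> C\<^sup>2 * mdist W (f x) (f y)"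
    by (simp add: sq)
qed

section \<open>Minimum and maximum of two powers\<close>

definition min_powr :: "real \<Rightarrow> real \<Rightarrow> real \<Rightarrow> real" where
  "min_powr a b u = min (u powr a) (u powr b)"

text \<open>For exponents \<open>1 / \<theta>\<close> and \<open>\<theta>\<close> this is
  \<open>eta\<close> at positive arguments, up to the factor \<open>L\<close>. As a maximum of
  powers it can be multiplied without a case distinction at 1.\<close>

definition max_powr :: "real \<Rightarrow> real \<Rightarrow> real \<Rightarrow> real" where
  "max_powr a b u = max (u powr a) (u powr b)"

lemma powr_mono_cases:
  fixes a b u :: real
  assumes "a \<le> b" "0 < u"
  shows "1 \<le> u \<Longrightarrow> u powr a \<le> u powr b" "u \<le> 1 \<Longrightarrow> u powr b \<le> u powr a"
  using assms by (auto intro: powr_mono powr_mono')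

lemma min_powr_pos: "0 < u \<Longrightarrow> 0 < min_powr a b u"
  by (simp add: min_powr_def)

lemma max_powr_pos: "0 < u \<Longrightarrow> 0 < max_powr a b u"
  by (auto simp: max_powr_def max_def)

lemma min_powr_one [simp]: "min_powr a b 1 = 1"
  by (simp add: min_powr_def)

lemma max_powr_one [simp]: "max_powr a b 1 = 1"
  by (simp add: max_powr_def)

lemma min_powr_ge_one: "a \<le> b \<Longrightarrow> 1 \<le> u \<Longrightarrow> min_powr a b u = u powr a"
  using powr_mono_cases(1)[of a b u] by (simp add: min_powr_def)

lemma max_powr_ge_one: "a \<le> b \<Longrightarrow> 1 \<le> u \<Longrightarrow> max_powr a b u = u powr b"
  using powr_mono_cases(1)[of a b u] by (simp add: max_powr_def)

lemma powr_between:
  fixes u :: real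
  assumes "a \<le> \<alpha>" "\<alpha> \<le> b" "0 < u"
  shows "min_powr a b u \<le> u powr \<alpha>" "u powr \<alpha> \<le> max_powr a b u"
  using powr_mono_cases[OF assms(1,3)] powr_mono_cases[OF assms(2,3)]
  by (cases "1 \<le> u"; auto simp: min_powr_def max_powr_def)+

text \<open>The exponent that attains the minimum at \<open>v\<close> also gives an upper bound at
  \<open>u * v\<close>.\<close>

lemma min_powr_mult_le:
  fixes u v :: real
  assumes "0 < u" "0 < v"
  shows "min_powr a b (u * v) \<le> max_powr a b u * min_powr a b v"
proof -
  obtain e where e: "e \<in> {a, b}" "min_powr a b v = v powr e"
    unfolding min_powr_def min_def by (metis insertCI)
  then have "min_powr a b (u * v) \<le> u powr e * v powr e"
    using assms by (auto simp: min_powr_def powr_mult)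
  also have "\<dots> \<le> max_powr a b u * v powr e"
    using e by (intro mult_right_mono) (auto simp: max_powr_def)
  finally show ?thesis by (simp add: e)
qed

lemma min_powr_mult_ge:
  fixes u v :: real
  assumes "0 < u" "0 < v"
  shows "min_powr a b u * min_powr a b v \<le> min_powr a b (u * v)"
proof -
  have "min_powr a b u * min_powr a b v \<le> u powr e * v powr e" if "e \<in> {a, b}" for e
    using that assms min_powr_pos[of u a b] min_powr_pos[of v a b]
    by (intro mult_mono) (auto simp: min_powr_def)
  then show ?thesis using assms by (simp add: min_powr_def[of a b "u * v"] powr_mult)
qed

text \<open>Inversion exchanges minimum and maximum. This cancels the distortion of a quasi-symmetry
  against the decay of the extended heights.\<close>

lemma max_powr_inverse:
  assumes "0 < r" "0 < t"
  shows "max_powr a b (r / t) * min_powr a b (t / r) = 1"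
proof -
  have "min (inverse p) (inverse q) = inverse (max p q)" if "0 < p" "0 < q" for p q :: real
    using that by (auto simp: min_def max_def)
  moreover have "(t / r) powr e = inverse ((r / t) powr e)" for e
    using assms by (simp add: powr_divide)
  ultimately have "min_powr a b (t / r) = inverse (max_powr a b (r / t))"
    using assms by (simp add: min_powr_def max_powr_def)
  then show ?thesis using max_powr_pos[of "r / t" a b] assms by simp
qed

lemma min_powr_mono:
  fixes u v :: real
  assumes "0 \<le> a" "0 \<le> b" "0 < u" "u \<le> v"
  shows "min_powr a b u \<le> min_powr a b v"
proof -
  have "u powr a \<le> v powr a" "u powr b \<le> v powr b" using assms by (auto intro: powr_mono2)
  then show ?thesis by (auto simp: min_powr_def)
qed

section \<open>Power quasi-symmetries in product form\<close>

lemma one_div_le_self: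
  fixes \<theta> :: real
  assumes "1 \<le> \<theta>"
  shows "1 / \<theta> \<le> \<theta>"
proof -
  have "1 / \<theta> \<le> 1" using assms by simp
  also note assms
  finally show ?thesis .
qed

lemma eta_eq:
  assumes "1 \<le> \<theta>" "0 < t"
  shows "eta \<theta> L t = L * max_powr (1 / \<theta>) \<theta> t"
  using powr_mono_cases[OF one_div_le_self[OF assms(1)] assms(2)] assms(2)
  by (cases "t < 1") (simp_all add: eta_def max_powr_def max_absorb1 max_absorb2)

lemma power_quasi_symmetryD:
  assumes "power_quasi_symmetry \<theta> L Z W f"
  shows "1 \<le> \<theta>" "1 \<le> L" "inj_on f (mspace Z)" "f ` mspace Z = mspace W"
proof -
  show "1 \<le> \<theta>" "1 \<le> L" using assms by (simp_all add: power_quasi_symmetry_def)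
  have "homeo Z W f" using assms by (simp add: power_quasi_symmetry_def)
  then show "inj_on f (mspace Z)" "f ` mspace Z = mspace W" by (rule homeo_mspaceD)+
qed

lemma power_quasi_symmetry_mdist_pos:
  assumes "power_quasi_symmetry \<theta> L Z W f" "x \<in> mspace Z" "y \<in> mspace Z" "x \<noteq> y"
  shows "0 < mdist W (f x) (f y)"
proof (rule mdist_pos)
  show "f x \<in> mspace W" "f y \<in> mspace W"
    using power_quasi_symmetryD(4)[OF assms(1)] assms(2,3) by blast+
  show "f x \<noteq> f y" using power_quasi_symmetryD(3)[OF assms(1)] assms by (meson inj_onD)
qed

text \<open>The condition \<open>x \<noteq> z\<close> keeps the argument of \<open>eta\<close>
  positive, as \<open>eta_eq\<close> requires.\<close>

lemma power_quasi_symmetry_bound: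
  assumes "power_quasi_symmetry \<theta> L Z W f" "x \<in> mspace Z" "y \<in> mspace Z" "z \<in> mspace Z"
    "x \<noteq> z" "y \<noteq> z"
  shows "mdist W (f x) (f z)
      \<le> L * max_powr (1 / \<theta>) \<theta> (mdist Z x z / mdist Z y z) * mdist W (f y) (f z)"
proof -
  have d: "0 < mdist Z x z" "0 < mdist Z y z" using assms by (simp_all add: mdist_pos)
  have "mdist W (f x) (f z) / mdist W (f y) (f z) \<le> eta \<theta> L (mdist Z x z / mdist Z y z)"
    using assms unfolding power_quasi_symmetry_def by blast
  also have "\<dots> = L * max_powr (1 / \<theta>) \<theta> (mdist Z x z / mdist Z y z)"
    using d power_quasi_symmetryD(1)[OF assms(1)] by (intro eta_eq) auto
  finally show ?thesis
    using power_quasi_symmetry_mdist_pos[OF assms(1,3,4,6)] by (simp only: pos_divide_le_eq)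
qed

section \<open>The height of a power quasi-symmetry\<close>

text \<open>The value \<open>c = 0\<close> is allowed, so that maps without a lower snowflake bound
  are covered. A second point keeps the index set of the supremum in \<open>height\<close>
  nonempty.\<close>

locale power_quasi_symmetric =
  fixes Z :: "'a metric" and W :: "'b metric" and f :: "'a \<Rightarrow> 'b" and \<theta> L \<alpha> c :: real
  assumes qs: "power_quasi_symmetry \<theta> L Z W f"
    and two_points: "\<And>x. x \<in> mspace Z \<Longrightarrow> \<exists>y\<in>mspace Z. y \<noteq> x"
    and \<alpha>: "1 / \<theta> \<le> \<alpha>" "\<alpha> \<le> \<theta>"
    and c: "0 \<le> c" "\<And>x y. x \<in> mspace Z \<Longrightarrow> y \<in> mspace Z \<Longrightarrow>
          c * mdist Z x y powr \<alpha> \<le> mdist W (f x) (f y)"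
begin

abbreviation "d \<equiv> mdist Z"
abbreviation "d' x y \<equiv> mdist W (f x) (f y)"
abbreviation "lo \<equiv> min_powr (1 / \<theta>) \<theta>"
abbreviation "hi \<equiv> max_powr (1 / \<theta>) \<theta>"

text \<open>The least value at \<open>s\<close> that the growth bounds with exponents
  \<open>1 / \<theta>\<close> and \<open>\<theta>\<close> and constant 1 permit, given the value
  \<open>d' x z\<close> at \<open>d x z\<close>.\<close>

definition contrib :: "'a \<Rightarrow> 'a \<Rightarrow> real \<Rightarrow> real" where
  "contrib x z s = d' x z * lo (s / d x z)"

definition height :: "'a \<Rightarrow> real \<Rightarrow> real" where
  "height x s = max (SUP z\<in>mspace Z - {x}. contrib x z s) (c * s powr \<alpha>)"

lemma parameters: "1 \<le> \<theta>" "1 \<le> L" "1 / \<theta> \<le> \<theta>" "0 < \<alpha>"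
proof -
  show 1: "1 \<le> \<theta>" "1 \<le> L" using power_quasi_symmetryD[OF qs] by auto
  then show "1 / \<theta> \<le> \<theta>" by (intro one_div_le_self)
  have "0 < 1 / \<theta>" using 1 by simp
  then show "0 < \<alpha>" using \<alpha> by linarith
qed

lemma dist_pos:
  assumes "x \<in> mspace Z" "y \<in> mspace Z" "x \<noteq> y"
  shows "0 < d x y" "0 < d' x y"
  using mdist_pos[OF assms] power_quasi_symmetry_mdist_pos[OF qs assms] by auto

lemma qs_bound:
  assumes "x \<in> mspace Z" "y \<in> mspace Z" "z \<in> mspace Z" "y \<noteq> x" "z \<noteq> x"
  shows "d' x z \<le> L * hi (d x z / d x y) * d' x y"
  using power_quasi_symmetry_bound[OF qs, of z y x] assms by (simp add: mdist_commute)

text \<open>Quasi-symmetry replaces \<open>d' x z\<close> by \<open>d' x y\<close> at the cost of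
  \<open>hi (d x z / d x y)\<close>, which cancels against a factor of \<open>lo\<close>. The bound
  no longer involves \<open>z\<close>, so the supremum is finite; for \<open>s = d x y\<close> it is
  \<open>L * d' x y\<close>.\<close>

lemma contrib_le:
  assumes "x \<in> mspace Z" "y \<in> mspace Z" "z \<in> mspace Z" "y \<noteq> x" "z \<noteq> x" "0 < s"
  shows "contrib x z s \<le> L * hi (s / d x y) * d' x y"
proof -
  have p: "0 < d x y" "0 < d x z" using dist_pos assms by auto
  have "contrib x z s \<le> L * hi (d x z / d x y) * d' x y * lo (s / d x z)"
    unfolding contrib_def using assms p min_powr_pos[of "s / d x z"]
    by (intro mult_right_mono qs_bound) (auto simp: less_imp_le)
  also have "lo (s / d x z) \<le> hi (s / d x y) * lo (d x y / d x z)"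
    using min_powr_mult_le[of "s / d x y" "d x y / d x z"] p assms by simp
  then have "L * hi (d x z / d x y) * d' x y * lo (s / d x z)
      \<le> L * hi (d x z / d x y) * d' x y * (hi (s / d x y) * lo (d x y / d x z))"
    using parameters p max_powr_pos[of "d x z / d x y"]
    by (intro mult_left_mono) (auto simp: less_imp_le)
  also have "\<dots> = L * hi (s / d x y) * d' x y * (hi (d x z / d x y) * lo (d x y / d x z))"
    by (simp add: mult_ac)
  also have "\<dots> = L * hi (s / d x y) * d' x y" using max_powr_inverse p by simp
  finally show ?thesis .
qed

lemma bdd_contrib:
  assumes "x \<in> mspace Z" "0 < s"
  shows "bdd_above ((\<lambda>z. contrib x z s) ` (mspace Z - {x}))"
proof -
  obtain y where "y \<in> mspace Z" "y \<noteq> x" using two_points assms by blast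
  then show ?thesis using contrib_le assms by (intro bdd_aboveI2) auto
qed

lemma contrib_le_height:
  assumes "x \<in> mspace Z" "z \<in> mspace Z" "z \<noteq> x" "0 < s"
  shows "contrib x z s \<le> height x s"
  unfolding height_def using bdd_contrib assms by (intro max.coboundedI1 cSUP_upper) auto

lemma height_least:
  assumes "x \<in> mspace Z" "c * s powr \<alpha> \<le> v"
    and "\<And>z. z \<in> mspace Z \<Longrightarrow> z \<noteq> x \<Longrightarrow> contrib x z s \<le> v"
  shows "height x s \<le> v"
  unfolding height_def using two_points assms by (intro max.boundedI cSUP_least) auto

lemma height_pos:
  assumes "x \<in> mspace Z" "0 < s"
  shows "0 < height x s"
proof -
  obtain z where z: "z \<in> mspace Z" "z \<noteq> x" using two_points assms by blast
  then have "0 < contrib x z s"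
    using dist_pos[of x z] min_powr_pos assms by (simp add: contrib_def)
  with contrib_le_height[of x z s] show ?thesis using z assms by linarith
qed

text \<open>Both bounds hold for every term and pass to the supremum: for \<open>contrib\<close> by
  the product estimates for \<open>lo\<close>, for \<open>c * s powr \<alpha>\<close> because
  \<alpha> lies between the two exponents.\<close>

lemma height_growth:
  assumes x: "x \<in> mspace Z" and st: "0 < s" "s \<le> t"
  shows "height x s * (t / s) powr (1 / \<theta>) \<le> height x t"
    and "height x t \<le> height x s * (t / s) powr \<theta>"
proof -
  have t: "0 < t" "1 \<le> t / s" using st by auto
  have lo: "lo (t / s) = (t / s) powr (1 / \<theta>)" and hi: "hi (t / s) = (t / s) powr \<theta>"
    using min_powr_ge_one max_powr_ge_one parameters t by auto
  have \<alpha>_between: "(t / s) powr (1 / \<theta>) \<le> (t / s) powr \<alpha>" "(t / s) powr \<alpha> \<le> (t / s) powr \<theta>"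
    using powr_between[OF \<alpha>, of "t / s"] t lo hi by auto
  have t_eq: "t powr \<alpha> = s powr \<alpha> * (t / s) powr \<alpha>" using st t by (simp flip: powr_mult)
  \<comment> \<open>Dividing leaves \<open>height x s\<close> alone on the left, the form that
    \<open>height_least\<close> proves.\<close>
  have "height x s \<le> height x t / lo (t / s)"
  proof (rule height_least[OF x])
    have "c * s powr \<alpha> * lo (t / s) \<le> c * t powr \<alpha>"
      using \<alpha>_between c unfolding lo t_eq by (simp add: mult.assoc mult_left_mono)
    also have "\<dots> \<le> height x t" by (simp add: height_def)
    finally show "c * s powr \<alpha> \<le> height x t / lo (t / s)"
      using min_powr_pos st t by (simp add: le_divide_eq)
  next
    fix z assume z: "z \<in> mspace Z" "z \<noteq> x"
    then have p: "0 < d x z" "0 < d' x z" using dist_pos x by auto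
    have "contrib x z s * lo (t / s) = d' x z * (lo (t / s) * lo (s / d x z))"
      by (simp add: contrib_def)
    also have "\<dots> \<le> contrib x z t"
      unfolding contrib_def using min_powr_mult_ge[of "t / s" "s / d x z"] p st t
      by (intro mult_left_mono) auto
    also have "\<dots> \<le> height x t" using contrib_le_height x z t by simp
    finally show "contrib x z s \<le> height x t / lo (t / s)"
      using min_powr_pos st t by (simp add: le_divide_eq)
  qed
  then show "height x s * (t / s) powr (1 / \<theta>) \<le> height x t"
    using min_powr_pos[of "t / s" "1 / \<theta>" \<theta>] st t by (simp add: lo le_divide_eq)
  show "height x t \<le> height x s * (t / s) powr \<theta>"
  proof (rule height_least[OF x])
    have "c * t powr \<alpha> \<le> c * s powr \<alpha> * (t / s) powr \<theta>"
      using \<alpha>_between c unfolding t_eq by (simp add: mult.assoc mult_left_mono)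
    also have "\<dots> \<le> height x s * (t / s) powr \<theta>"
      by (intro mult_right_mono) (auto simp: height_def)
    finally show "c * t powr \<alpha> \<le> height x s * (t / s) powr \<theta>" .
  next
    fix z assume z: "z \<in> mspace Z" "z \<noteq> x"
    then have p: "0 < d x z" "0 < d' x z" using dist_pos x by auto
    have "contrib x z t \<le> d' x z * (hi (t / s) * lo (s / d x z))"
      unfolding contrib_def using min_powr_mult_le[of "t / s" "s / d x z"] p st t
      by (intro mult_left_mono) auto
    also have "\<dots> = contrib x z s * (t / s) powr \<theta>" by (simp add: contrib_def hi)
    also have "\<dots> \<le> height x s * (t / s) powr \<theta>"
      using contrib_le_height x z st by (intro mult_right_mono) auto
    finally show "contrib x z t \<le> height x s * (t / s) powr \<theta>" .
  qed
qed

lemma lo_halve: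
  assumes "0 < s" "0 < r"
  shows "lo (s / r) \<le> 2 powr \<theta> * lo (s / (2 * r))"
  using min_powr_mult_le[of 2 "s / (2 * r)" "1 / \<theta>" \<theta>] assms parameters
  by (simp add: max_powr_ge_one)

text \<open>
  By the triangle inequality \<open>y\<close> is at distance at least \<open>d(x, z) / 2\<close> from \<open>x\<close> or from \<open>z\<close>. In the
  first case \<open>d'(x, z)\<close> is controlled by \<open>d'(x, y)\<close>, in the second one by \<open>d'(y, z)\<close>.
\<close>

lemma contrib_change_point:
  assumes xyz: "x \<in> mspace Z" "y \<in> mspace Z" "z \<in> mspace Z" "x \<noteq> y" "z \<noteq> x"
    and s: "d x y \<le> s"
  shows "contrib x z s \<le> L * 4 powr \<theta> * height y s"
proof -
  define r t q where "r = d x z" and "t = d x y" and "q = d y z"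
  have rt: "0 < r" "0 < t" "t \<le> s" "0 < s"
    using dist_pos[of x z] dist_pos[of x y] xyz s by (auto simp: r_def t_def)
  have four: "(4::real) powr \<theta> = 2 powr \<theta> * 2 powr \<theta>" by (simp flip: powr_mult)
  have two: "1 \<le> (2::real) powr \<theta>" using parameters by (intro ge_one_powr_ge_zero) auto
  have L: "0 \<le> L" using parameters by simp
  have nonneg: "0 \<le> lo u" if "0 < u" for u using min_powr_pos[OF that] by (rule less_imp_le)
  have exps: "0 \<le> 1 / \<theta>" "0 \<le> \<theta>" using parameters by auto
  show ?thesis
  proof (cases "r / 2 \<le> t")
    case True
    \<comment> \<open>Halving \<open>r\<close> makes \<open>s / t\<close> and
      \<open>t / (r / 2)\<close> both at least 1, where \<open>lo\<close> is a single power and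
      hence multiplicative.\<close>
    have "lo (s / r) \<le> lo (s / (r / 2))"
      using exps rt by (intro min_powr_mono) (auto simp: field_simps)
    also have "s / (r / 2) = s / t * (t / (r / 2))" using rt by simp
    also have "lo \<dots> = lo (s / t) * lo (t / (r / 2))"
    proof -
      have "1 \<le> s / t" "1 \<le> t / (r / 2)" using True rt by auto
      moreover from this have "1 \<le> s / t * (t / (r / 2))"
        by (metis mult_mono mult_1 zero_le_one order_trans)
      ultimately show ?thesis
        using parameters by (simp only: min_powr_ge_one powr_mult)
    qed
    also have "\<dots> \<le> lo (s / t) * (2 powr \<theta> * lo (t / r))"
      using lo_halve[of t "r / 2"] rt nonneg by (intro mult_left_mono) auto
    finally have lo: "lo (s / r) \<le> lo (s / t) * (2 powr \<theta> * lo (t / r))" .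
    have "contrib x z s \<le> L * hi (r / t) * d' x y * lo (s / r)"
      unfolding contrib_def r_def[symmetric] using qs_bound[of x y z] xyz rt nonneg
      by (intro mult_right_mono) (auto simp: r_def t_def)
    also have "\<dots> \<le> L * hi (r / t) * d' x y * (lo (s / t) * (2 powr \<theta> * lo (t / r)))"
      using lo L max_powr_pos[of "r / t"] rt by (intro mult_left_mono) (auto simp: less_imp_le)
    also have "\<dots> = L * 2 powr \<theta> * (d' x y * lo (s / t)) * (hi (r / t) * lo (t / r))"
      by (simp add: mult_ac)
    also have "\<dots> = L * 2 powr \<theta> * contrib y x s"
      using max_powr_inverse rt by (simp add: contrib_def t_def mdist_commute)
    also have "\<dots> \<le> L * 2 powr \<theta> * height y s"
      using contrib_le_height[of y x s] xyz rt L by (intro mult_left_mono) auto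
    also have "\<dots> \<le> L * 4 powr \<theta> * height y s"
      using two L height_pos[of y s] xyz rt unfolding four
      by (intro mult_right_mono mult_left_mono) auto
    finally show ?thesis .
  next
    case False
    have "r \<le> t + q" "q \<le> t + r"
      using mdist_triangle[of x Z y z] mdist_triangle[of y Z x z] xyz
      by (auto simp: r_def t_def q_def mdist_commute)
    \<comment> \<open>Now \<open>q\<close> and \<open>r\<close> agree up to a factor of 2. Replacing
      one by the other costs \<open>2 powr \<theta>\<close> in the distortion and again in
      \<open>lo\<close>, hence \<open>4 powr \<theta>\<close>.\<close>
    then have q: "0 < q" "r \<le> 2 * q" "q \<le> 2 * r" using False rt by auto
    have "z \<noteq> y" using False rt by (auto simp: r_def t_def)
    have "hi (r / q) \<le> 2 powr \<theta>"
    proof -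
      have "(r / q) powr e \<le> 2 powr \<theta>" if "0 \<le> e" "e \<le> \<theta>" for e
      proof -
        have "(r / q) powr e \<le> 2 powr e"
          using q rt that by (intro powr_mono2) (auto simp: divide_le_eq)
        also have "\<dots> \<le> 2 powr \<theta>" using that by (intro powr_mono) auto
        finally show ?thesis .
      qed
      then show ?thesis using exps parameters by (simp add: max_powr_def)
    qed
    have "d' x z \<le> L * hi (r / q) * d' y z"
      using power_quasi_symmetry_bound[OF qs, of x y z] xyz \<open>z \<noteq> y\<close> by (simp add: r_def q_def)
    also have "\<dots> \<le> L * 2 powr \<theta> * d' y z"
      using \<open>hi (r / q) \<le> _\<close> L by (intro mult_right_mono mult_left_mono) auto
    finally have d': "d' x z \<le> L * 2 powr \<theta> * d' y z" .
    have "lo (s / r) \<le> 2 powr \<theta> * lo (s / (2 * r))" using lo_halve rt by simp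
    also have "lo (s / (2 * r)) \<le> lo (s / q)"
      using exps rt q by (intro min_powr_mono) (auto simp: frac_le)
    finally have lo: "lo (s / r) \<le> 2 powr \<theta> * lo (s / q)" by simp
    have "contrib x z s \<le> (L * 2 powr \<theta> * d' y z) * (2 powr \<theta> * lo (s / q))"
      unfolding contrib_def r_def[symmetric] using d' lo L nonneg rt by (intro mult_mono) auto
    also have "\<dots> = L * 4 powr \<theta> * contrib y z s" by (simp add: four contrib_def q_def mult_ac)
    also have "\<dots> \<le> L * 4 powr \<theta> * height y s"
      using contrib_le_height[of y z s] \<open>z \<noteq> y\<close> xyz rt L by (intro mult_left_mono) auto
    finally show ?thesis .
  qed
qed

text \<open>The constant is dictated by the change of base point; the growth bounds hold with
  constant 1 and the edge bounds with constants 1 and \<open>L\<close>.\<close>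

lemma cone_extension_height: "cone_extension Z W f height (1 / \<theta>) \<theta> (L * 4 powr \<theta>)"
proof
  define B where "B = L * 4 powr \<theta>"
  have "1 \<le> (4::real) powr \<theta>" using parameters by (intro ge_one_powr_ge_zero) auto
  then have "L \<le> B" using parameters mult_left_mono[of 1 "4 powr \<theta>" L] by (simp add: B_def)
  with parameters have B: "1 \<le> B" "L \<le> B" by auto
  have enlarge: "v \<le> B * v" if "0 \<le> v" for v using B that mult_right_mono[of 1 B v] by simp
  show "1 \<le> L * 4 powr \<theta>" using B by (simp add: B_def)
  show "f ` mspace Z = mspace W" by (rule power_quasi_symmetryD(4)[OF qs])
  show "0 < 1 / \<theta>" "0 < \<theta>" using parameters by auto
  show "0 < height x s" if "x \<in> mspace Z" "0 < s" for x s using height_pos that .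
  show "height x s * (t / s) powr (1 / \<theta>) \<le> L * 4 powr \<theta> * height x t"
    if "x \<in> mspace Z" "0 < s" "s \<le> t" for x s t
    using height_growth(1)[OF that] enlarge[OF less_imp_le[OF height_pos[of x t]]] that
    unfolding B_def by linarith
  show "height x t \<le> L * 4 powr \<theta> * height x s * (t / s) powr \<theta>"
    if "x \<in> mspace Z" "0 < s" "s \<le> t" for x s t
  proof -
    have "0 \<le> height x s * (t / s) powr \<theta>" using height_pos[of x s] that by simp
    from enlarge[OF this] height_growth(2)[OF that] show ?thesis
      unfolding B_def by (simp only: mult.assoc)
  qed
  show "height x s \<le> L * 4 powr \<theta> * height y s"
    if xy: "x \<in> mspace Z" "y \<in> mspace Z" and s: "0 < s" "d x y \<le> s" for x y s
  proof (cases "x = y")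
    case True
    then show ?thesis
      using enlarge[OF less_imp_le[OF height_pos[of y s]]] that unfolding B_def by simp
  next
    case False
    show ?thesis
    proof (rule height_least[OF xy(1)])
      have "c * s powr \<alpha> \<le> height y s" by (simp add: height_def)
      then show "c * s powr \<alpha> \<le> L * 4 powr \<theta> * height y s"
        using enlarge[OF less_imp_le[OF height_pos[of y s]]] that unfolding B_def by linarith
    qed (use contrib_change_point xy s False in auto)
  qed
  fix x y assume xy: "x \<in> mspace Z" "y \<in> mspace Z" "x \<noteq> y"
  note p = dist_pos[OF xy]
  have "d' x y = contrib x y (d x y)" using p by (simp add: contrib_def)
  also have "\<dots> \<le> height x (d x y)" using contrib_le_height xy p by simp
  finally show "d' x y \<le> L * 4 powr \<theta> * height x (d x y)"
    using enlarge[OF less_imp_le[OF height_pos[OF xy(1) p(1)]]] unfolding B_def by linarith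
  have Ld: "L * d' x y \<le> B * d' x y" using B by (intro mult_right_mono) auto
  show "height x (d x y) \<le> L * 4 powr \<theta> * d' x y"
  proof (rule height_least[OF xy(1)])
    show "c * d x y powr \<alpha> \<le> L * 4 powr \<theta> * d' x y"
      using c(2)[OF xy(1,2)] enlarge[OF mdist_nonneg[of W "f x" "f y"]]
      unfolding B_def by linarith
    fix z assume "z \<in> mspace Z" "z \<noteq> x"
    then show "contrib x z (d x y) \<le> L * 4 powr \<theta> * d' x y"
      using contrib_le[of x y z "d x y"] xy p Ld by (simp add: B_def)
  qed
qed

text \<open>Since \<alpha> lies between the exponents, \<open>lo\<close> is at most the power
  \<alpha>, and the distances \<open>d x z\<close> cancel in every \<open>contrib\<close>.\<close>

lemma height_snowflake_upper:
  assumes "snowflake \<alpha> C Z W f" "c \<le> C" "0 \<le> C" "x \<in> mspace Z" "0 < s"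
  shows "height x s \<le> C * s powr \<alpha>"
proof (rule height_least[OF assms(4)])
  show "c * s powr \<alpha> \<le> C * s powr \<alpha>" using assms by (intro mult_right_mono) auto
  fix z assume z: "z \<in> mspace Z" "z \<noteq> x"
  then have p: "0 < d x z" "0 < d' x z" using dist_pos assms by auto
  have "contrib x z s \<le> (C * d x z powr \<alpha>) * (s / d x z) powr \<alpha>"
    unfolding contrib_def
    using assms z p powr_between(1)[OF \<alpha>, of "s / d x z"] min_powr_pos[of "s / d x z"]
    by (intro mult_mono) (auto simp: snowflake_def less_imp_le)
  also have "\<dots> = C * s powr \<alpha>" using p assms by (simp add: mult.assoc flip: powr_mult)
  finally show "contrib x z s \<le> C * s powr \<alpha>" .
qed

end

text \<open>
  The best constant \<open>c \<le> 1\<close> in the lower snowflake bound makes \<open>height\<close> work for every admissible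
  \<open>C\<close> at once. It may be 0 if \<open>f\<close> is not an \<open>\<alpha>\<close>-snowflake mapping.
\<close>

lemma best_lower_snowflake_constant:
  fixes f :: "'a \<Rightarrow> 'b"
  obtains c :: real where "0 \<le> c" "c \<le> 1"
    "\<And>x y. x \<in> mspace Z \<Longrightarrow> y \<in> mspace Z \<Longrightarrow> c * mdist Z x y powr \<alpha> \<le> mdist W (f x) (f y)"
    "\<And>C. 1 \<le> C \<Longrightarrow> snowflake \<alpha> C Z W f \<Longrightarrow> inverse C \<le> c"
proof -
  \<comment> \<open>The cap at 1 bounds \<open>A\<close> and yields \<open>c \<le> C\<close> for all
    \<open>C \<ge> 1\<close>, without excluding \<open>inverse C\<close>.\<close>
  define A where "A = {c. 0 \<le> c \<and> c \<le> 1 \<and> (\<forall>x\<in>mspace Z. \<forall>y\<in>mspace Z.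
      c * mdist Z x y powr \<alpha> \<le> mdist W (f x) (f y))}"
  have A0: "0 \<in> A" by (auto simp: A_def)
  then have nonempty: "A \<noteq> {}" by blast
  have bdd: "bdd_above A" by (rule bdd_aboveI[of _ 1]) (auto simp: A_def)
  show thesis
  proof (rule that[of "Sup A"])
    show "0 \<le> Sup A" using A0 bdd by (rule cSup_upper)
    show "Sup A \<le> 1" by (intro cSup_least[OF nonempty]) (auto simp: A_def)
    show "inverse C \<le> Sup A" if "1 \<le> C" "snowflake \<alpha> C Z W f" for C
      using that bdd by (intro cSup_upper) (auto simp: A_def snowflake_def inverse_le_1_iff)
    fix x y assume xy: "x \<in> mspace Z" "y \<in> mspace Z"
    show "Sup A * mdist Z x y powr \<alpha> \<le> mdist W (f x) (f y)"
    \<comment> \<open>Division by the power needs a positive distance; at distance 0 the left side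
      vanishes because \<open>0 powr \<alpha> = 0\<close>.\<close>
    proof (cases "mdist Z x y = 0")
      case False
      then have p: "0 < mdist Z x y powr \<alpha>" using mdist_nonneg[of Z x y] by simp
      then have "Sup A \<le> mdist W (f x) (f y) / mdist Z x y powr \<alpha>"
        using xy by (intro cSup_least[OF nonempty]) (auto simp: A_def le_divide_eq)
      then show ?thesis using p by (simp add: le_divide_eq)
    qed simp
  qed
qed

theorem theorem1p1:
  shows "\<exists>(k :: real \<Rightarrow> real \<Rightarrow> real) (k' :: real \<Rightarrow> real \<Rightarrow> real).
    \<forall>\<theta> L (Z :: 'a metric) (W :: 'b metric) f.
      1 \<le> \<theta> \<longrightarrow> 1 \<le> L \<longrightarrow>
      (\<exists>T \<subseteq> mspace Z. card T = 3) \<longrightarrow> (\<exists>T \<subseteq> mspace W. card T = 3) \<longrightarrow>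
      power_quasi_symmetry \<theta> L Z W f \<longrightarrow>
      (\<exists>fhat. rough_quasi_isometry \<theta> (k \<theta> L) (Con_h Z) (Con_h W) fhat) \<and>
      (\<forall>\<alpha>>0. \<exists>fhat.
        (1 / \<theta> \<le> \<alpha> \<and> \<alpha> \<le> \<theta> \<longrightarrow>
          rough_quasi_isometry \<theta> (k \<theta> L) (Con_h Z) (Con_h W) fhat) \<and>
        (\<forall>C\<ge>1. snowflake \<alpha> C Z W f \<longrightarrow>
          rough_similarity \<alpha> (k' \<alpha> C) (Con_h Z) (Con_h W) fhat))"
proof -
  \<comment> \<open>The error depends on the two exponents and the constant only, not on the spaces,
    the map or the height, so it can be fixed in advance.\<close>
  define k where "k = (\<lambda>\<theta> L. cone_extension.error (1 / \<theta>) \<theta> (L * 4 powr \<theta>))"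
  define k' where "k' = (\<lambda>\<alpha> C. cone_extension.error \<alpha> \<alpha> (C\<^sup>2))"
  have ext: "\<exists>fhat.
        (1 / \<theta> \<le> \<alpha> \<and> \<alpha> \<le> \<theta> \<longrightarrow>
          rough_quasi_isometry \<theta> (k \<theta> L) (Con_h Z) (Con_h W) fhat) \<and>
        (\<forall>C\<ge>1. snowflake \<alpha> C Z W f \<longrightarrow>
          rough_similarity \<alpha> (k' \<alpha> C) (Con_h Z) (Con_h W) fhat)"
    if \<alpha>_pos: "0 < \<alpha>" and T: "T \<subseteq> mspace Z" "card T = 3" and qs: "power_quasi_symmetry \<theta> L Z W f"
    for \<theta> L \<alpha> and Z :: "'a metric" and W :: "'b metric" and f T
  proof (cases "1 / \<theta> \<le> \<alpha> \<and> \<alpha> \<le> \<theta>")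
    case True
    obtain c where c_best: "0 \<le> c" "c \<le> 1"
      "\<And>x y. x \<in> mspace Z \<Longrightarrow> y \<in> mspace Z \<Longrightarrow> c * mdist Z x y powr \<alpha> \<le> mdist W (f x) (f y)"
      "\<And>C. 1 \<le> C \<Longrightarrow> snowflake \<alpha> C Z W f \<Longrightarrow> inverse C \<le> c"
      using best_lower_snowflake_constant[of Z \<alpha> W f] by metis
    have other: "\<exists>y\<in>mspace Z. y \<noteq> x" for x
    proof (rule ccontr)
      assume "\<not> ?thesis"
      then have "T \<subseteq> {x}" using T by blast
      then have "card T \<le> 1" using card_mono[of "{x}" T] by simp
      with T show False by simp
    qed
    interpret power_quasi_symmetric Z W f \<theta> L \<alpha> c
      by unfold_locales (use qs True c_best other in auto)
    let ?fhat = "cone_extension.lift f height"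
    have "rough_quasi_isometry \<theta> (k \<theta> L) (Con_h Z) (Con_h W) ?fhat"
      unfolding k_def using parameters
      by (intro cone_extension.lift_rough_quasi_isometry cone_extension_height) auto
    moreover have "rough_similarity \<alpha> (k' \<alpha> C) (Con_h Z) (Con_h W) ?fhat"
      if C: "1 \<le> C" and sf: "snowflake \<alpha> C Z W f" for C
    proof -
      have "cone_extension Z W f height \<alpha> \<alpha> (C\<^sup>2)"
      proof (rule cone_extension_snowflake[OF sf \<alpha>_pos C])
        fix x s assume x: "x \<in> mspace Z" "0 < (s::real)"
        show "height x s \<le> C * s powr \<alpha>"
          using c_best(2) C by (intro height_snowflake_upper[OF sf _ _ x]) auto
        \<comment> \<open>The height was built from \<open>c\<close> before \<open>C\<close> was
          given; optimality of \<open>c\<close> makes it serve every admissible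
          \<open>C\<close>.\<close>
        have "inverse C * s powr \<alpha> \<le> c * s powr \<alpha>"
          using c_best(4)[OF C sf] by (intro mult_right_mono) auto
        also have "\<dots> \<le> height x s" by (simp add: height_def)
        finally show "s powr \<alpha> \<le> C * height x s" using C by (simp add: field_simps)
      qed
      then show ?thesis unfolding k'_def by (intro cone_extension.lift_rough_similarity) auto
    qed
    ultimately show ?thesis by blast
  next
    case False
    have "rough_similarity \<alpha> (k' \<alpha> C) (Con_h Z) (Con_h W) (cone_extension.lift f (\<lambda>_ s. s powr \<alpha>))"
      if C: "1 \<le> C" and sf: "snowflake \<alpha> C Z W f" for C
    proof -
      have "v \<le> C * v" if "0 \<le> v" for v using C that mult_right_mono[of 1 C v] by simp
      then have "cone_extension Z W f (\<lambda>_ s. s powr \<alpha>) \<alpha> \<alpha> (C\<^sup>2)"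
        by (intro cone_extension_snowflake[OF sf \<alpha>_pos C]) auto
      then show ?thesis unfolding k'_def by (intro cone_extension.lift_rough_similarity) auto
    qed
    with False show ?thesis by blast
  qed
  show ?thesis
  proof (rule exI[of _ k], rule exI[of _ k'], intro allI impI)
    fix \<theta> L and Z :: "'a metric" and W :: "'b metric" and f
    assume \<theta>: "1 \<le> \<theta>" and "\<exists>T\<subseteq>mspace Z. card T = 3"
      and qs: "power_quasi_symmetry \<theta> L Z W f"
    then obtain T where T: "T \<subseteq> mspace Z" "card T = 3" by blast
    \<comment> \<open>The exponent 1 is always in the admissible range, so \<open>ext\<close> at
      \<open>\<alpha> = 1\<close> gives a rough quasi-isometry without any snowflake
      assumption.\<close>
    have "1 / \<theta> \<le> 1 \<and> 1 \<le> \<theta>" using \<theta> by simp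
    then have "\<exists>fhat. rough_quasi_isometry \<theta> (k \<theta> L) (Con_h Z) (Con_h W) fhat"
      using ext[OF zero_less_one T qs] by blast
    with ext[OF _ T qs]
    show "(\<exists>fhat. rough_quasi_isometry \<theta> (k \<theta> L) (Con_h Z) (Con_h W) fhat) \<and>
      (\<forall>\<alpha>>0. \<exists>fhat.
        (1 / \<theta> \<le> \<alpha> \<and> \<alpha> \<le> \<theta> \<longrightarrow>
          rough_quasi_isometry \<theta> (k \<theta> L) (Con_h Z) (Con_h W) fhat) \<and>
        (\<forall>C\<ge>1. snowflake \<alpha> C Z W f \<longrightarrow>
          rough_similarity \<alpha> (k' \<alpha> C) (Con_h Z) (Con_h W) fhat))"
      by simp
  qed
qed

end
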